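(* Let $n\ge2$. Let $U$ and $V$ be unitaries in $\mathcal F_n^k$ and $\mathcal F_n^h$ ($k,h\ge1$), respectively, satisfying the equations $$U_hVU_h^*=U^*,\qquad V_kUV_k^*=V^*.$$ Then $U$ is a solution of the polynomial matrix equation $$(U_r^*U^*U_r)_r\,U\,(U_r^*U^*U_r)_r^*=U_r^*UU_r,\qquad(\ast)$$ where $r$ can be taken as the maximum of $k$ and $h$. Conversely, given $r\ge1$, every unitary solution $U\in\mathcal F_n^r$ of equation $(\ast)$ gives rise to an automorphism $\lambda_U$ of $\mathcal O_n$, with inverse induced by $V:=U_r^*U^*U_r$ (i.e. $\lambda_U^{-1}=\lambda_V$).
   Context: For $n\ge2$, $\mathcal O_n$ is the Cuntz algebra, generated by isometries $S_1,\dots,S_n$ with $\sum_i S_iS_i^*=1$. $\mathcal F_n^k=\mathrm{span}\{S_\alpha S_\beta^*:\alpha,\beta\in\{1,\dots,n\}^k\}\cong M_{n^k}(\mathbb C)$, where $S_\alpha=S_{\alpha_1}\cdots S_{\alpha_k}$. $\varphi(a)=\sum_iS_iaS_i^*$. For a unitary $u\in\mathcal O_n$, $\lambda_u$ is the unital endomorphism of $\mathcal O_n$ with $\lambda_u(S_i)=u^*S_i$. For any unitary $u\in\mathcal O_n$ and positive integer $k$, $u_k:=u^*\varphi(u^* )\cdots\varphi^{k-1}(u^* )$, and $u_k^*$ always means $(u_k)^*$. In particular $(U_r^*U^*U_r)_r$ denotes $v_r$ for the unitary $v=U_r^*U^*U_r$, and $(U_r^*U^*U_r)_r^*$ its adjoint.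 *)

theory Defs
  imports "HOL-Analysis.Analysis"
begin

text \<open>Unital complex C*-algebras. The real Banach algebra classes supply the norm, the topology
  and completeness; \<open>norm 1 = 1\<close> excludes the zero algebra.\<close>

class cstar_algebra = real_normed_algebra_1 + banach +
  fixes scaleC :: "complex \<Rightarrow> 'a \<Rightarrow> 'a" (infixr \<open>*\<^sub>C\<close> 75)
    and star :: "'a \<Rightarrow> 'a"
  assumes scaleC_add_right: "c *\<^sub>C (x + y) = c *\<^sub>C x + c *\<^sub>C y"
    and scaleC_add_left: "(c + d) *\<^sub>C x = c *\<^sub>C x + d *\<^sub>C x"
    and scaleC_scaleC: "c *\<^sub>C d *\<^sub>C x = (c * d) *\<^sub>C x"
    and scaleC_of_real: "complex_of_real r *\<^sub>C x = r *\<^sub>R x"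
    and scaleC_mult_left: "(c *\<^sub>C x) * y = c *\<^sub>C (x * y)"
    and scaleC_mult_right: "x * (c *\<^sub>C y) = c *\<^sub>C (x * y)"
    and norm_scaleC: "norm (c *\<^sub>C x) = cmod c * norm x"
    and star_add: "star (x + y) = star x + star y"
    and star_scaleC: "star (c *\<^sub>C x) = cnj c *\<^sub>C star x"
    and star_mult: "star (x * y) = star y * star x"
    and star_star: "star (star x) = x"
    and cstar_identity: "norm (star x * x) = (norm x)\<^sup>2"

global_interpretation cvec: vector_space "scaleC :: complex \<Rightarrow> 'a \<Rightarrow> 'a :: cstar_algebra"
  defines cspan = cvec.span
proof
  show "1 *\<^sub>C x = x" for x :: 'a
    using scaleC_of_real[of 1 x] by simp
qed (simp_all add: scaleC_add_right scaleC_add_left scaleC_scaleC)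

definition unitary :: "'a::cstar_algebra \<Rightarrow> bool" where
  "unitary u \<longleftrightarrow> star u * u = 1 \<and> u * star u = 1"

definition cstar_subalgebra :: "'a::cstar_algebra set \<Rightarrow> bool" where
  "cstar_subalgebra B \<longleftrightarrow> closed B \<and> 1 \<in> B
     \<and> (\<forall>x\<in>B. \<forall>y\<in>B. x + y \<in> B \<and> x * y \<in> B)
     \<and> (\<forall>c. \<forall>x\<in>B. c *\<^sub>C x \<in> B) \<and> (\<forall>x\<in>B. star x \<in> B)"

definition unital_star_endomorphism :: "('a::cstar_algebra \<Rightarrow> 'a) \<Rightarrow> bool" where
  "unital_star_endomorphism f \<longleftrightarrow> f 1 = 1
     \<and> (\<forall>x y. f (x + y) = f x + f y \<and> f (x * y) = f x * f y)
     \<and> (\<forall>c x. f (c *\<^sub>C x) = c *\<^sub>C f x) \<and> (\<forall>x. f (star x) = star (f x))"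

definition star_automorphism :: "('a::cstar_algebra \<Rightarrow> 'a) \<Rightarrow> bool" where
  "star_automorphism f \<longleftrightarrow> unital_star_endomorphism f \<and> bij f"

text \<open>The type \<open>'a\<close> itself plays the role of the Cuntz algebra: \<open>is_cuntz_algebra n S\<close> says that it
  is generated, as a C*-algebra, by isometries \<open>S 1, \<dots>, S n\<close> whose range projections sum to 1.
  For \<open>n \<ge> 2\<close> these conditions determine the pair up to isomorphism (Cuntz), so no universal
  property is assumed. Values of \<open>S\<close> outside \<open>{1..n}\<close> are irrelevant.\<close>

definition is_cuntz_algebra :: "nat \<Rightarrow> (nat \<Rightarrow> 'a::cstar_algebra) \<Rightarrow> bool" where
  "is_cuntz_algebra n S \<longleftrightarrow> (\<forall>i\<in>{1..n}. star (S i) * S i = 1)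
     \<and> (\<Sum>i=1..n. S i * star (S i)) = 1
     \<and> cstar_subalgebra hull (S ` {1..n}) = UNIV"

definition words :: "nat \<Rightarrow> nat \<Rightarrow> nat list set" where
  "words n k = {\<alpha>. set \<alpha> \<subseteq> {1..n} \<and> length \<alpha> = k}"

definition word_isom :: "(nat \<Rightarrow> 'a::cstar_algebra) \<Rightarrow> nat list \<Rightarrow> 'a" where
  "word_isom S \<alpha> = prod_list (map S \<alpha>)"

definition cuntz_core :: "nat \<Rightarrow> (nat \<Rightarrow> 'a::cstar_algebra) \<Rightarrow> nat \<Rightarrow> 'a set" where
  "cuntz_core n S k =
     cspan {word_isom S \<alpha> * star (word_isom S \<beta>) | \<alpha> \<beta>. \<alpha> \<in> words n k \<and> \<beta> \<in> words n k}"

definition cuntz_shift :: "nat \<Rightarrow> (nat \<Rightarrow> 'a::cstar_algebra) \<Rightarrow> 'a \<Rightarrow> 'a" where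
  "cuntz_shift n S a = (\<Sum>i=1..n. S i * a * star (S i))"

text \<open>\<open>cocyc n S u k\<close> is \<open>u\<^sub>k\<close>, the product (in this order) of the \<open>j\<close>-th shift iterates of
  \<open>star u\<close> for \<open>j = 0, \<dots>, k - 1\<close>.\<close>

definition cocyc :: "nat \<Rightarrow> (nat \<Rightarrow> 'a::cstar_algebra) \<Rightarrow> 'a \<Rightarrow> nat \<Rightarrow> 'a" where
  "cocyc n S u k = prod_list (map (\<lambda>j. (cuntz_shift n S ^^ j) (star u)) [0..<k])"

definition induced_by ::
    "nat \<Rightarrow> (nat \<Rightarrow> 'a::cstar_algebra) \<Rightarrow> 'a \<Rightarrow> ('a \<Rightarrow> 'a) \<Rightarrow> bool" where
  "induced_by n S u f \<longleftrightarrow>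
     unital_star_endomorphism f \<and> (\<forall>i\<in>{1..n}. f (S i) = star u * S i)"

text \<open>Only meaningful when exactly one map satisfies \<open>induced_by n S u\<close>.\<close>

definition cuntz_endo :: "nat \<Rightarrow> (nat \<Rightarrow> 'a::cstar_algebra) \<Rightarrow> 'a \<Rightarrow> 'a \<Rightarrow> 'a" where
  "cuntz_endo n S u = (THE f. induced_by n S u f)"

end

theory Submission
  imports Defs
begin

text \<open>Write \<open>S\<^sub>i\<close> for the generators, \<open>\<phi>\<close> for the canonical shift and \<open>u\<^sub>k\<close> for the cocycle of \<open>u\<close>.
  If \<open>\<lambda>\<^sub>u\<close> is the endomorphism with \<open>S\<^sub>i \<mapsto> u\<^sup>* S\<^sub>i\<close>, then \<open>\<lambda>\<^sub>u (S\<^sub>\<alpha>) = u\<^sub>k S\<^sub>\<alpha>\<close> for words of length \<open>k\<close>,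
  so \<open>\<lambda>\<^sub>u\<close> acts on the core of level \<open>k\<close> as conjugation by \<open>u\<^sub>k\<close> (\<open>cuntz_endo_core\<close>). As
  \<open>u\<^sub>k\<^sub>+\<^sub>l = u\<^sub>k \<phi>\<^sup>k (u\<^sub>l)\<close> and \<open>\<phi>\<^sup>k\<close> maps into the commutant of that core, every \<open>u\<^sub>r\<close> with \<open>r \<ge> k\<close> gives
  the same conjugation (\<open>cocyc_conj_core\<close>).

  This proves the first half at once: both hypotheses hold with \<open>r\<close> in place of \<open>h\<close> and \<open>k\<close>; one
  says that \<open>V\<close> is \<open>U\<^sub>r\<^sup>* U\<^sup>* U\<^sub>r\<close>, and the other is then the claimed equation. In the second half the
  equation reads \<open>\<lambda>\<^sub>V (U) = V\<^sup>*\<close>. Hence \<open>\<lambda>\<^sub>V (\<lambda>\<^sub>U (S\<^sub>i)) = V V\<^sup>* S\<^sub>i = S\<^sub>i\<close>, so \<open>\<lambda>\<^sub>V \<circ> \<lambda>\<^sub>U\<close> is the identity, and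
  since \<open>\<lambda>\<^sub>V\<close> is injective the two are inverse to each other (\<open>cuntz_endo_inverse\<close>).

  The analytic work is the existence, injectivity and uniqueness of \<open>\<lambda>\<^sub>u\<close>. For the first two,
  put \<open>T\<^sub>i = u\<^sup>* S\<^sub>i\<close> and compare the values \<open>x\<close> and \<open>y\<close> that one formal linear combination of
  monomials \<open>S\<^sub>\<alpha> S\<^sub>\<beta>\<^sup>*\<close> takes in the two families. In degree 0 (words of equal length) the values are
  conjugate by a cocycle, so they have equal norms. In general, compression by a suitable isometry
  shows that a homogeneous part is no larger than the whole (\<open>norm_degree_part_le\<close>), and \<open>norm y\<close>
  is at most \<open>norm x\<close> times the number of degrees that occur. Applied to \<open>(x\<^sup>* x)\<^sup>N\<close>, this factor grows
  only linearly in \<open>N\<close>, and the C*-identity removes it (\<open>rel_contractive\<close>). By symmetry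
  \<open>norm y = norm x\<close>, and \<open>x \<mapsto> y\<close> extends from a dense subalgebra to an isometric endomorphism.

  Uniqueness needs that unital \<^emph>\<open>*\<close>-endomorphisms are continuous. If \<open>a\<close> is self-adjoint with
  \<open>norm a < 1\<close>, there is a self-adjoint \<open>b\<close> commuting with \<open>a\<close> such that \<open>a\<^sup>2 + b\<^sup>2 = 1\<close>. An endomorphism
  preserves this relation, and it exhibits the image of \<open>a\<close> as the real part of a unitary.
  The same square root yields the orthogonality of the ranges of the \<open>S\<^sub>i\<close>, which is hidden in
  \<open>\<Sum> S\<^sub>i S\<^sub>i\<^sup>* = 1\<close>.\<close>

section \<open>Elementary norm estimates in C*-algebras\<close>

lemma star_0 [simp]: "star (0::'a::cstar_algebra) = 0"
  using star_add[of "0::'a" 0] by simp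

lemma star_1 [simp]: "star (1::'a::cstar_algebra) = 1"
  using star_mult[of "star 1::'a" 1] star_star[of "1::'a"] by simp

declare star_star [simp]

lemma star_scaleR: "star (r *\<^sub>R x) = r *\<^sub>R star (x::'a::cstar_algebra)"
  using star_scaleC[of "complex_of_real r" x] by (simp add: scaleC_of_real)

lemma star_minus: "star (- x) = - star (x::'a::cstar_algebra)"
  using star_scaleR[of "-1" x] by simp

lemma star_diff: "star (x - y) = star x - star (y::'a::cstar_algebra)"
  using star_add[of x "- y"] by (simp add: star_minus)

lemma star_power: "star (x ^ k) = star (x::'a::cstar_algebra) ^ k"
  by (induction k) (simp_all add: star_mult power_commutes)

lemma star_sum: "star (sum f A) = (\<Sum>x\<in>A. star (f x :: 'a::cstar_algebra))"
  by (induction A rule: infinite_finite_induct) (simp_all add: star_add)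

lemma norm_star [simp]: "norm (star x) = norm (x::'a::cstar_algebra)"
proof -
  have le: "norm y \<le> norm (star y)" for y :: 'a
  proof (cases "y = 0")
    case False
    have "norm y * norm y \<le> norm (star y) * norm y"
      using cstar_identity[of y] norm_mult_ineq[of "star y" y] by (simp add: power2_eq_square)
    then show ?thesis using False by simp
  qed simp
  show ?thesis using le[of x] le[of "star x"] by simp
qed

lemma bounded_linear_star: "bounded_linear (star :: 'a::cstar_algebra \<Rightarrow> 'a)"
  by (rule bounded_linear_intro[where K = 1]) (simp_all add: star_add star_scaleR)

lemma bounded_linear_scaleC: "bounded_linear (scaleC c :: 'a::cstar_algebra \<Rightarrow> 'a)"
proof (rule bounded_linear_intro[where K = "cmod c"])
  fix r and x :: 'a
  show "c *\<^sub>C r *\<^sub>R x = r *\<^sub>R c *\<^sub>C x"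
    by (simp add: scaleC_of_real[symmetric] scaleC_scaleC mult.commute)
qed (simp_all add: scaleC_add_right norm_scaleC mult.commute)

lemmas tendsto_star = bounded_linear.tendsto[OF bounded_linear_star]
lemmas tendsto_scaleC = bounded_linear.tendsto[OF bounded_linear_scaleC]

lemma norm_isometry_mult:
  fixes s x :: "'a::cstar_algebra"
  assumes "star s * s = 1"
  shows "norm (s * x) = norm x"
proof -
  have "star (s * x) * (s * x) = star x * (star s * s) * x"
    by (simp only: star_mult mult.assoc)
  then have "(norm (s * x))\<^sup>2 = (norm x)\<^sup>2"
    using cstar_identity[of "s * x"] cstar_identity[of x] assms by simp
  then show ?thesis by simp
qed

lemma norm_mult_star_isometry:
  fixes s x :: "'a::cstar_algebra"
  assumes "star s * s = 1"
  shows "norm (x * star s) = norm x"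
  using norm_isometry_mult[OF assms, of "star x"] norm_star[of "x * star s"]
  by (simp add: star_mult)

lemma norm_isometry: "star s * s = 1 \<Longrightarrow> norm (s::'a::cstar_algebra) = 1"
  using norm_isometry_mult[of s 1] by simp

lemma unitary_star: "unitary u \<Longrightarrow> unitary (star u)"
  by (simp add: unitary_def)

lemma unitary_mult:
  assumes "unitary u" "unitary v"
  shows "unitary (u * v)"
proof -
  have "star (u * v) * (u * v) = star v * (star u * u) * v"
    "u * v * star (u * v) = u * (v * star v) * star u"
    by (simp_all only: star_mult mult.assoc)
  then show ?thesis using assms by (simp add: unitary_def)
qed

lemma norm_unitary_conj:
  fixes u x :: "'a::cstar_algebra"
  assumes "unitary u"
  shows "norm (u * x * star u) = norm x"
  using assms by (simp add: unitary_def norm_isometry_mult norm_mult_star_isometry)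

lemma norm_compress_le:
  fixes w x :: "'a::cstar_algebra"
  assumes "star w * w = 1"
  shows "norm (star w * x * w) \<le> norm x"
proof -
  have "norm (star w * x * w) \<le> norm (star w) * norm x * norm w"
    by (meson norm_mult_ineq order_trans mult_right_mono norm_ge_zero)
  then show ?thesis using norm_isometry[OF assms] by simp
qed

lemma norm_selfadjoint_power:
  fixes z :: "'a::cstar_algebra"
  assumes "star z = z"
  shows "norm (z ^ 2 ^ m) = norm z ^ 2 ^ m"
proof (induction m)
  case (Suc m)
  have "norm (z ^ 2 ^ Suc m) = norm (star (z ^ 2 ^ m) * z ^ 2 ^ m)"
    by (simp add: star_power assms power_add[symmetric] mult_2)
  then show ?case using Suc by (simp add: cstar_identity power_mult[symmetric] mult.commute)
qed simp

text \<open>The substitute for functional calculus: \<open>1 - a\<^sup>2\<close> has a square root \<open>1 - c\<close>, where \<open>c\<close> is the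
  fixed point of \<open>c \<mapsto> (a\<^sup>2 + c\<^sup>2) / 2\<close>. This map contracts a ball of radius less than 1.\<close>

lemma sqrt_one_minus_square:
  fixes a :: "'a::cstar_algebra"
  assumes sa: "star a = a" and less: "norm a < 1"
  obtains b where "star b = b" "a * b = b * a" "a * a + b * b = 1"
proof -
  \<comment> \<open>The smaller root of \<open>t = ((norm a)\<^sup>2 + t\<^sup>2) / 2\<close>, so that the ball of radius \<open>t\<close> is preserved.\<close>
  define t where "t = 1 - sqrt (1 - (norm a)\<^sup>2)"
  have a1: "(norm a)\<^sup>2 < 1"
    using less by (simp add: power_less_one_iff)
  have t: "0 \<le> t" "t < 1"
    using a1 by (auto simp: t_def)
  have "(sqrt (1 - (norm a)\<^sup>2))\<^sup>2 = 1 - (norm a)\<^sup>2"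
    using a1 by simp
  then have t_eq: "(norm a)\<^sup>2 + t\<^sup>2 = 2 * t"
    by (simp add: t_def power2_eq_square algebra_simps)
  define F :: "'a \<Rightarrow> 'a" where "F c = (1/2) *\<^sub>R (a * a + c * c)" for c
  define s where "s = {c. star c = c} \<inter> {c. a * c = c * a} \<inter> cball 0 t"
  have "closed s"
    unfolding s_def
    by (intro closed_Int closed_Collect_eq closed_cball continuous_intros
        bounded_linear.continuous_on[OF bounded_linear_star])
  then have "complete s" by (simp add: complete_eq_closed)
  moreover have "0 \<in> s" using t by (simp add: s_def)
  then have "s \<noteq> {}" by blast
  moreover have "F ` s \<subseteq> s"
  proof (intro image_subsetI)
    fix c assume c: "c \<in> s"
    then have ac: "star c = c" "a * c = c * a" "norm c \<le> t" by (auto simp: s_def)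
    have "a * (c * c) = c * c * a" by (metis ac(2) mult.assoc)
    then have "a * F c = F c * a"
      by (simp add: F_def distrib_left distrib_right mult.assoc)
    moreover have "star (F c) = F c"
      by (simp add: F_def star_scaleR star_add star_mult sa ac)
    moreover have "norm (F c) \<le> t"
    proof -
      have "norm (a * a + c * c) \<le> norm a * norm a + norm c * norm c"
        by (meson add_mono norm_mult_ineq norm_triangle_le)
      also have "\<dots> \<le> (norm a)\<^sup>2 + t\<^sup>2"
        using mult_mono[OF ac(3) ac(3)] t(1) by (simp add: power2_eq_square)
      finally show ?thesis using t_eq by (simp add: F_def)
    qed
    ultimately show "F c \<in> s" by (simp add: s_def)
  qed
  moreover have "dist (F c) (F d) \<le> t * dist c d" if "c \<in> s" "d \<in> s" for c d
  proof -
    have cd: "norm c \<le> t" "norm d \<le> t" using that by (auto simp: s_def)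
    have "F c - F d = (1/2) *\<^sub>R (c * (c - d) + (c - d) * d)"
      by (simp add: F_def algebra_simps)
    also have "norm \<dots> \<le> (1/2) * (norm c * norm (c - d) + norm (c - d) * norm d)"
      by simp (meson add_mono norm_mult_ineq norm_triangle_le)
    also have "\<dots> \<le> (1/2) * (t * norm (c - d) + norm (c - d) * t)"
      using cd t by (intro mult_left_mono add_mono mult_mono) auto
    finally show ?thesis by (simp add: dist_norm)
  qed
  ultimately obtain c where c: "c \<in> s" "F c = c"
    using Banach_fix[of s t F] t by blast
  have "2 *\<^sub>R c = a * a + c * c"
    using arg_cong[OF c(2), of "\<lambda>x. 2 *\<^sub>R x"] by (simp add: F_def)
  then have "a * a + (1 - c) * (1 - c) = 1"
    by (simp add: algebra_simps scaleR_2)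
  moreover have "star (1 - c) = 1 - c" "a * (1 - c) = (1 - c) * a"
    using c(1) by (simp_all add: s_def star_diff algebra_simps)
  ultimately show ?thesis using that by blast
qed

text \<open>A commuting self-adjoint pair on the unit circle is the real and imaginary part of the
  unitary \<open>h + \<i> k\<close>, and \<open>h\<^sup>2 - k\<^sup>2\<close> is the real part of its square.\<close>

lemma unit_circle_norm_le:
  fixes h k :: "'a::cstar_algebra"
  assumes sa: "star h = h" "star k = k" and comm: "h * k = k * h" and eq: "h * h + k * k = 1"
  shows "norm h \<le> 1" and "norm (h * h - k * k) \<le> 1"
proof -
  define u where "u = h + \<i> *\<^sub>C k"
  have su: "star u = h - \<i> *\<^sub>C k"
    using cvec.scale_minus_left[of \<i> k] by (simp add: u_def star_add star_scaleC sa)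
  note expand = distrib_left distrib_right left_diff_distrib right_diff_distrib
    scaleC_mult_left scaleC_mult_right scaleC_scaleC
    cvec.scale_right_diff_distrib comm
  have m1: "(-1) *\<^sub>C x = - x" for x :: 'a
    using scaleC_of_real[of "-1" x] by simp
  have "star u * u = 1" unfolding su unfolding u_def
    using eq by (simp add: expand m1)
  then have nu: "norm u = 1" by (rule norm_isometry)
  have re: "norm ((1/2) *\<^sub>R (x + star x)) \<le> 1" if "norm x \<le> 1" for x :: 'a
    using that norm_triangle_ineq[of x "star x"] by simp
  have "h = (1/2) *\<^sub>R (u + star u)" unfolding su unfolding u_def
    by (simp add: scaleR_2[symmetric])
  then show "norm h \<le> 1" using re[of u] nu by simp
  have "h * h - k * k = (1/2) *\<^sub>R (u * u + star (u * u))"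
    unfolding star_mult su unfolding u_def
    by (simp add: expand m1 scaleR_2[symmetric] algebra_simps)
  moreover have "norm (u * u) \<le> 1" using norm_mult_ineq[of u u] nu by simp
  ultimately show "norm (h * h - k * k) \<le> 1" using re[of "u * u"] by simp
qed

lemma norm_one_minus_two_square_le:
  fixes x :: "'a::cstar_algebra"
  assumes "star x = x" and "norm x \<le> 1"
  shows "norm (1 - 2 *\<^sub>R (x * x)) \<le> 1"
proof -
  have le: "norm (1 - 2 *\<^sub>R ((t *\<^sub>R x) * (t *\<^sub>R x))) \<le> 1" if "0 < t" "t < 1" for t
  proof -
    have "t * norm x \<le> t" using that assms(2) by (intro mult_left_le) auto
    moreover have "norm (t *\<^sub>R x) = t * norm x" using that by simp
    ultimately have "norm (t *\<^sub>R x) < 1" using that by linarith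
    have sx: "star (t *\<^sub>R x) = t *\<^sub>R x" by (simp add: star_scaleR assms)
    from \<open>norm (t *\<^sub>R x) < 1\<close> obtain b where b: "star b = b" "t *\<^sub>R x * b = b * (t *\<^sub>R x)"
        "(t *\<^sub>R x) * (t *\<^sub>R x) + b * b = 1"
      by (rule sqrt_one_minus_square[OF sx])
    have "1 - 2 *\<^sub>R y = - (y - z)" if "y + z = 1" for y z :: 'a
      unfolding that[symmetric] by (simp add: scaleR_2)
    from this[OF b(3)]
    have "1 - 2 *\<^sub>R ((t *\<^sub>R x) * (t *\<^sub>R x)) = - ((t *\<^sub>R x) * (t *\<^sub>R x) - b * b)" .
    then show ?thesis using unit_circle_norm_le(2)[OF sx b] by (simp add: norm_minus_commute)
  qed
  have lim: "((\<lambda>t::real. norm (1 - 2 *\<^sub>R ((t *\<^sub>R x) * (t *\<^sub>R x))))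
      \<longlongrightarrow> norm (1 - 2 *\<^sub>R ((1 *\<^sub>R x) * (1 *\<^sub>R x)))) (at_left 1)"
    by (intro tendsto_intros)
  have "\<forall>\<^sub>F t in at_left (1::real). norm (1 - 2 *\<^sub>R ((t *\<^sub>R x) * (t *\<^sub>R x))) \<le> 1"
    using eventually_at_left_real[OF zero_less_one] by eventually_elim (use le in auto)
  then show ?thesis
    using tendsto_upperbound[OF lim _ trivial_limit_at_left_real] by simp
qed

text \<open>Squares of self-adjoint contractions lie in the ball of radius \<open>1/2\<close> around \<open>1/2\<close>.\<close>

lemma norm_diff_squares_le:
  fixes x y :: "'a::cstar_algebra"
  assumes "star x = x" "norm x \<le> 1" "star y = y" "norm y \<le> 1"
  shows "norm (x * x - y * y) \<le> 1"
proof -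
  have "x * x - y * y = (1/2) *\<^sub>R ((1 - 2 *\<^sub>R (y * y)) - (1 - 2 *\<^sub>R (x * x)))"
    by (simp add: scaleR_diff_right)
  also have "norm \<dots> \<le> (1/2) * (norm (1 - 2 *\<^sub>R (y * y)) + norm (1 - 2 *\<^sub>R (x * x)))"
    using norm_triangle_ineq4[of "1 - 2 *\<^sub>R (y * y)" "1 - 2 *\<^sub>R (x * x)"] by simp
  finally show ?thesis
    using norm_one_minus_two_square_le[of x] norm_one_minus_two_square_le[of y] assms by simp
qed

text \<open>A self-adjoint case of the extremality of \<open>1\<close> in the unit ball. The hypotheses pass from \<open>c\<close>
  to \<open>2 c\<close> because \<open>1 + 2 c = (1 + c)\<^sup>2 - c\<^sup>2\<close>, and they bound \<open>c\<close>.\<close>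

lemma one_extreme_selfadjoint:
  fixes c :: "'a::cstar_algebra"
  assumes sa: "star c = c" and "norm (1 + c) \<le> 1" "norm (1 - c) \<le> 1"
  shows "c = 0"
proof -
  have bound: "norm d \<le> 1" if "norm (1 + d) \<le> 1" "norm (1 - d) \<le> 1" for d :: 'a
  proof -
    have "norm ((1 + d) - (1 - d)) \<le> 2"
      using norm_triangle_ineq4[of "1 + d" "1 - d"] that by linarith
    moreover have "(1 + d) - (1 - d) = 2 *\<^sub>R d" by (simp add: scaleR_2)
    ultimately show ?thesis by simp
  qed
  have scaled: "norm (1 + (2::real) ^ m *\<^sub>R c) \<le> 1 \<and> norm (1 - (2::real) ^ m *\<^sub>R c) \<le> 1" for m
  proof (induction m)
    case (Suc m)
    define d where "d = (2::real) ^ m *\<^sub>R c"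
    have sd: "star d = d" by (simp add: d_def star_scaleR sa)
    have d: "norm (1 + d) \<le> 1" "norm (1 - d) \<le> 1" using Suc by (simp_all add: d_def)
    have "1 + 2 *\<^sub>R d = (1 + d) * (1 + d) - d * d" "1 - 2 *\<^sub>R d = (1 - d) * (1 - d) - d * d"
      by (simp_all add: scaleR_2 algebra_simps)
    then have "norm (1 + 2 *\<^sub>R d) \<le> 1" "norm (1 - 2 *\<^sub>R d) \<le> 1"
      using norm_diff_squares_le[of "1 + d" d] norm_diff_squares_le[of "1 - d" d] d bound[OF d]
      by (simp_all add: star_add star_diff sd)
    then show ?case by (simp add: d_def)
  qed (use assms in simp)
  have le: "norm c \<le> (1/2) ^ m" for m :: nat
  proof -
    have "2 ^ m * norm c \<le> 1" using bound scaled[of m] by fastforce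
    then show ?thesis by (simp add: field_simps power_one_over)
  qed
  have "(\<lambda>m. (1/2) ^ m) \<longlonglongrightarrow> (0::real)" by (simp add: LIMSEQ_realpow_zero)
  then have "norm c \<le> 0" using le by (intro LIMSEQ_le_const) auto
  then show ?thesis by simp
qed

text \<open>Automatic contractivity: a self-adjoint \<open>a\<close> of norm less than 1 lies on a commuting unit
  circle, and this algebraic relation is preserved.\<close>

lemma star_endomorphism_contractive:
  fixes f :: "'a::cstar_algebra \<Rightarrow> 'a"
  assumes f: "unital_star_endomorphism f"
  shows "norm (f x) \<le> norm x"
proof -
  have f1: "f 1 = 1" and add: "\<And>x y. f (x + y) = f x + f y" and mult: "\<And>x y. f (x * y) = f x * f y"
    and sc: "\<And>c x. f (c *\<^sub>C x) = c *\<^sub>C f x" and st: "\<And>x. f (star x) = star (f x)"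
    using f by (auto simp: unital_star_endomorphism_def)
  have sr: "f (r *\<^sub>R y) = r *\<^sub>R f y" for r y
    using sc[of "complex_of_real r" y] by (simp add: scaleC_of_real)
  have unit_ball: "norm (f a) \<le> 1" if a: "star a = a" "norm a < 1" for a
  proof -
    obtain b where b: "star b = b" "a * b = b * a" "a * a + b * b = 1"
      using sqrt_one_minus_square[OF a] .
    have "star (f a) = f a" "star (f b) = f b" "f a * f b = f b * f a" "f a * f a + f b * f b = 1"
      using a(1) b f1 by (simp_all add: st[symmetric] mult[symmetric] add[symmetric])
    then show ?thesis by (rule unit_circle_norm_le(1))
  qed
  have selfadjoint: "norm (f a) \<le> norm a" if a: "star a = a" for a
  proof (rule field_le_epsilon)
    fix e :: real assume e: "e > 0"
    define t where "t = norm a + e"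
    have t: "t > 0" "norm a < t" using e by (simp_all add: t_def add_nonneg_pos)
    then have "norm (f ((1/t) *\<^sub>R a)) \<le> 1"
      by (intro unit_ball) (simp_all add: star_scaleR a)
    then have "norm (f a) \<le> t" using t by (simp add: sr field_simps)
    then show "norm (f a) \<le> norm a + e" by (simp add: t_def)
  qed
  have "(norm (f x))\<^sup>2 = norm (f (star x * x))"
    by (simp add: mult st cstar_identity)
  also have "\<dots> \<le> norm (star x * x)" by (rule selfadjoint) (simp add: star_mult)
  finally show ?thesis by (simp add: cstar_identity)
qed

lemma star_endomorphism_continuous:
  fixes f :: "'a::cstar_algebra \<Rightarrow> 'a"
  assumes f: "unital_star_endomorphism f"
  shows "continuous_on UNIV f"
proof -
  have sr: "f (r *\<^sub>R y) = r *\<^sub>R f y" for r y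
    using f by (auto simp: unital_star_endomorphism_def scaleC_of_real[symmetric])
  have "bounded_linear f"
    by (rule bounded_linear_intro[where K = 1])
      (use f sr star_endomorphism_contractive[OF f] in \<open>auto simp: unital_star_endomorphism_def\<close>)
  then show ?thesis by (rule bounded_linear.continuous_on[OF _ continuous_on_id])
qed

section \<open>Isometries with ranges summing to one\<close>

locale cuntz_family =
  fixes n :: nat and R :: "nat \<Rightarrow> 'a::cstar_algebra"
  assumes two_le: "2 \<le> n"
    and isometry: "\<And>i. i \<in> {1..n} \<Longrightarrow> star (R i) * R i = 1"
    and range_sum: "(\<Sum>i=1..n. R i * star (R i)) = 1"
begin

text \<open>Compressed by \<open>R j\<close>, the range projections other than the \<open>j\<close>-th sum to 0. Each
  compression \<open>p l\<close> satisfies \<open>norm (1 - 2 p l) \<le> 1\<close>, so that a multiple of \<open>p i\<close> is a symmetric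
  perturbation of \<open>1\<close> in the unit ball.\<close>

lemma orthogonal:
  assumes i: "i \<in> {1..n}" and j: "j \<in> {1..n}" and "i \<noteq> j"
  shows "star (R i) * R j = 0"
proof -
  define q where "q l = R l * star (R l)" for l
  define p where "p l = star (R j) * q l * R j" for l
  define I where "I = {1..n} - {i, j}"
  \<comment> \<open>The extra 1 keeps the divisor positive when \<open>n = 2\<close> and \<open>I\<close> is empty.\<close>
  define M where "M = real (card I) + 1"
  have M: "M \<ge> 1" by (simp add: M_def)
  have "sum q {1..n} = 1" using range_sum by (simp add: q_def)
  then have "(\<Sum>l=1..n. p l) = 1"
    unfolding p_def using isometry[OF j]
    by (simp only: sum_distrib_left[symmetric] sum_distrib_right[symmetric]) simp
  moreover have "p j = (star (R j) * R j) * (star (R j) * R j)"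
    by (simp only: p_def q_def mult.assoc)
  then have "p j = 1" using isometry[OF j] by simp
  moreover have "(\<Sum>l=1..n. p l) = p j + (p i + (\<Sum>l\<in>I. p l))"
  proof -
    have "{1..n} = insert j (insert i I)" "j \<notin> insert i I" "i \<notin> I" "finite I"
      using i j \<open>i \<noteq> j\<close> by (auto simp: I_def)
    then show ?thesis by (metis sum.insert finite_insert)
  qed
  ultimately have sum0: "(\<Sum>l\<in>I. p l) = - p i" by (simp add: eq_neg_iff_add_eq_0 add.commute)
  have refl: "norm (1 - 2 *\<^sub>R p l) \<le> 1" if "l \<in> {1..n}" for l
  proof -
    have "q l * q l = R l * (star (R l) * R l) * star (R l)" by (simp only: q_def mult.assoc)
    then have "q l * q l = q l" using isometry[OF that] by (simp add: q_def)
    moreover have "star (q l) = q l" by (simp add: q_def star_mult)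
    moreover have "norm (q l) \<le> 1"
      using norm_mult_star_isometry[OF isometry[OF that]] norm_isometry[OF isometry[OF that]]
      by (simp add: q_def)
    ultimately have "norm (1 - 2 *\<^sub>R q l) \<le> 1"
      using norm_one_minus_two_square_le[of "q l"] by simp
    moreover have "1 - 2 *\<^sub>R p l = star (R j) * (1 - 2 *\<^sub>R q l) * R j"
      using isometry[OF j] by (simp add: p_def left_diff_distrib right_diff_distrib)
    ultimately show ?thesis
      using norm_compress_le[OF isometry[OF j], of "1 - 2 *\<^sub>R q l"] by simp
  qed
  have "(2 / M) *\<^sub>R p i = 0"
  proof (rule one_extreme_selfadjoint)
    show "star ((2 / M) *\<^sub>R p i) = (2 / M) *\<^sub>R p i"
      by (simp add: star_scaleR p_def q_def star_mult mult.assoc)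
    have "(\<Sum>l\<in>I. 1 - 2 *\<^sub>R p l) = (M - 1) *\<^sub>R 1 + 2 *\<^sub>R p i"
      by (simp add: sum_subtractf scaleR_right.sum[symmetric] sum0 M_def of_real_def[symmetric])
    then have "1 + (2 / M) *\<^sub>R p i = (1 / M) *\<^sub>R (1 + (\<Sum>l\<in>I. 1 - 2 *\<^sub>R p l))"
      using M by (simp add: scaleR_add_right[symmetric] algebra_simps scaleR_left_diff_distrib)
    also have "norm \<dots> \<le> (1 / M) * (1 + (\<Sum>l\<in>I. 1))"
    proof -
      have "norm (\<Sum>l\<in>I. 1 - 2 *\<^sub>R p l) \<le> (\<Sum>l\<in>I. 1)"
        by (rule sum_norm_le) (auto simp: I_def intro: refl)
      then have "norm (1 + (\<Sum>l\<in>I. 1 - 2 *\<^sub>R p l)) \<le> 1 + (\<Sum>l\<in>I. 1)"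
        by (intro norm_triangle_le) simp
      then show ?thesis using M by (simp add: divide_right_mono)
    qed
    finally show "norm (1 + (2 / M) *\<^sub>R p i) \<le> 1" using M by (simp add: M_def add.commute)
    have "1 - (2 / M) *\<^sub>R p i = (1 - 1 / M) *\<^sub>R 1 + (1 / M) *\<^sub>R (1 - 2 *\<^sub>R p i)"
      by (simp add: scaleR_diff_right scaleR_diff_left)
    also have "norm \<dots> \<le> (1 - 1 / M) * 1 + (1 / M) * norm (1 - 2 *\<^sub>R p i)"
      using M by (intro norm_triangle_le) simp
    also have "\<dots> \<le> (1 - 1 / M) * 1 + (1 / M) * 1"
      using M refl[OF i] by (intro add_left_mono mult_left_mono) auto
    finally show "norm (1 - (2 / M) *\<^sub>R p i) \<le> 1" by simp
  qed
  then have "p i = 0" using M by simp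
  moreover have "p i = star (star (R i) * R j) * (star (R i) * R j)"
    by (simp add: p_def q_def star_mult mult.assoc)
  ultimately show ?thesis using cstar_identity[of "star (R i) * R j"] by simp
qed

lemma star_mult_generators:
  "i \<in> {1..n} \<Longrightarrow> j \<in> {1..n} \<Longrightarrow> star (R i) * R j = (if i = j then 1 else 0)"
  using isometry orthogonal by auto

abbreviation \<phi> :: "'a \<Rightarrow> 'a" where "\<phi> \<equiv> cuntz_shift n R"

lemma star_generator_shift:
  assumes "i \<in> {1..n}"
  shows "star (R i) * \<phi> a = a * star (R i)"
proof -
  have "star (R i) * \<phi> a = (\<Sum>j=1..n. (star (R i) * R j) * a * star (R j))"
    by (simp add: cuntz_shift_def sum_distrib_left mult.assoc)
  also have "\<dots> = (\<Sum>j=1..n. if j = i then a * star (R i) else 0)"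
    using assms by (intro sum.cong) (auto simp: star_mult_generators)
  finally show ?thesis using assms by simp
qed

lemma shift_star: "\<phi> (star a) = star (\<phi> a)"
  by (simp add: cuntz_shift_def star_sum star_mult mult.assoc)

lemma shift_generator: "i \<in> {1..n} \<Longrightarrow> \<phi> a * R i = R i * a"
  using arg_cong[OF star_generator_shift[of i "star a"], of star]
  by (simp add: star_mult shift_star)

lemma shift_mult: "\<phi> (a * b) = \<phi> a * \<phi> b"
proof -
  have "\<phi> a * \<phi> b = (\<Sum>i=1..n. R i * a * (star (R i) * \<phi> b))"
    by (subst (1) cuntz_shift_def) (simp add: sum_distrib_right mult.assoc)
  also have "\<dots> = (\<Sum>i=1..n. R i * (a * b) * star (R i))"
    by (intro sum.cong) (simp_all add: star_generator_shift mult.assoc)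
  finally show ?thesis by (simp add: cuntz_shift_def)
qed

lemma shift_1: "\<phi> 1 = 1"
  using range_sum by (simp add: cuntz_shift_def)

lemma shift_0: "\<phi> 0 = 0"
  by (simp add: cuntz_shift_def)

lemma shift_pow_mult: "(\<phi> ^^ k) (a * b) = (\<phi> ^^ k) a * (\<phi> ^^ k) b"
  by (induction k) (simp_all add: shift_mult)

lemma shift_pow_star: "(\<phi> ^^ k) (star a) = star ((\<phi> ^^ k) a)"
  by (induction k) (simp_all add: shift_star)

lemma shift_pow_1: "(\<phi> ^^ k) 1 = 1"
  by (induction k) (simp_all add: shift_1)

lemma shift_pow_0: "(\<phi> ^^ k) 0 = 0"
  by (induction k) (simp_all add: shift_0)

lemma shift_pow_unitary: "unitary u \<Longrightarrow> unitary ((\<phi> ^^ k) u)"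
  by (simp add: unitary_def shift_pow_mult[symmetric] shift_pow_star[symmetric] shift_pow_1)

subsection \<open>Words\<close>

abbreviation W :: "nat list \<Rightarrow> 'a" where "W \<equiv> word_isom R"

lemma word_Nil [simp]: "W [] = 1"
  by (simp add: word_isom_def)

lemma word_Cons [simp]: "W (i # \<alpha>) = R i * W \<alpha>"
  by (simp add: word_isom_def)

lemma word_append: "W (\<alpha> @ \<beta>) = W \<alpha> * W \<beta>"
  by (simp add: word_isom_def)

lemma star_word_mult:
  "set \<beta> \<subseteq> {1..n} \<Longrightarrow> set \<gamma> \<subseteq> {1..n} \<Longrightarrow> star (W \<beta>) * W \<gamma> =
    (if take (length \<beta>) \<gamma> = \<beta> then W (drop (length \<beta>) \<gamma>)
     else if take (length \<gamma>) \<beta> = \<gamma> then star (W (drop (length \<gamma>) \<beta>)) else 0)"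
proof (induction \<beta> \<gamma> rule: list_induct2')
  case (4 i \<beta> j \<gamma>)
  have "star (W (i # \<beta>)) * W (j # \<gamma>) = star (W \<beta>) * (star (R i) * R j) * W \<gamma>"
    by (simp add: star_mult mult.assoc)
  then show ?case using 4 by (simp add: star_mult_generators)
qed simp_all

lemma word_isometry: "set \<alpha> \<subseteq> {1..n} \<Longrightarrow> star (W \<alpha>) * W \<alpha> = 1"
  by (simp add: star_word_mult)

lemma star_word_shift:
  "set \<alpha> \<subseteq> {1..n} \<Longrightarrow> length \<alpha> \<le> k \<Longrightarrow>
    star (W \<alpha>) * (\<phi> ^^ k) a = (\<phi> ^^ (k - length \<alpha>)) a * star (W \<alpha>)"
proof (induction \<alpha> arbitrary: k)
  case (Cons i \<alpha>)
  then obtain m where k: "k = Suc m" by (cases k) auto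
  have "star (W (i # \<alpha>)) * (\<phi> ^^ k) a = star (W \<alpha>) * (star (R i) * \<phi> ((\<phi> ^^ m) a))"
    by (simp add: k star_mult mult.assoc)
  also have "\<dots> = (star (W \<alpha>) * (\<phi> ^^ m) a) * star (R i)"
    using Cons.prems by (simp add: star_generator_shift mult.assoc)
  also have "\<dots> = (\<phi> ^^ (m - length \<alpha>)) a * star (W (i # \<alpha>))"
    using Cons.prems by (simp add: Cons.IH k star_mult mult.assoc)
  finally show ?case by (simp add: k)
qed simp

lemma shift_word:
  "set \<alpha> \<subseteq> {1..n} \<Longrightarrow> (\<phi> ^^ length \<alpha>) a * W \<alpha> = W \<alpha> * a"
  using arg_cong[OF star_word_shift[of \<alpha> "length \<alpha>" "star a"], of star]
  by (simp add: star_mult shift_pow_star)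

subsection \<open>Cocycles\<close>

abbreviation cc :: "'a \<Rightarrow> nat \<Rightarrow> 'a" where "cc \<equiv> cocyc n R"

lemma cocyc_0: "cc u 0 = 1"
  by (simp add: cocyc_def)

lemma cocyc_Suc: "cc u (Suc k) = star u * \<phi> (cc u k)"
proof -
  have shift_prod: "\<phi> (prod_list xs) = prod_list (map \<phi> xs)" for xs
    by (induction xs) (simp_all add: shift_1 shift_mult)
  have "[0..<Suc k] = 0 # map Suc [0..<k]"
    by (simp add: upt_conv_Cons map_Suc_upt del: upt_Suc)
  then show ?thesis by (simp add: cocyc_def shift_prod comp_def del: upt_Suc)
qed

lemma cocyc_add: "cc u (k + l) = cc u k * (\<phi> ^^ k) (cc u l)"
  by (induction k) (simp_all add: cocyc_0 cocyc_Suc shift_mult mult.assoc)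

lemma cocyc_unitary: "unitary u \<Longrightarrow> unitary (cc u k)"
proof (induction k)
  case 0
  then show ?case by (simp add: cocyc_0 unitary_def)
next
  case (Suc k)
  then show ?case using shift_pow_unitary[of "cc u k" 1]
    by (simp add: cocyc_Suc unitary_mult unitary_star)
qed

lemma shift_pow_commutes_core:
  assumes "x \<in> cuntz_core n R k"
  shows "(\<phi> ^^ k) a * x = x * (\<phi> ^^ k) a"
  using assms unfolding cuntz_core_def
proof (induction rule: cvec.span_induct_alt)
  case (step c x y)
  then obtain \<alpha> \<beta> where x: "x = W \<alpha> * star (W \<beta>)" "\<alpha> \<in> words n k" "\<beta> \<in> words n k"
    by auto
  have "(\<phi> ^^ k) a * x = W \<alpha> * a * star (W \<beta>)"
    using shift_word[of \<alpha> a] x by (simp add: words_def mult.assoc[symmetric])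
  also have "\<dots> = x * (\<phi> ^^ k) a"
    using star_word_shift[of \<beta> k a] x by (simp add: words_def mult.assoc)
  finally show ?case using step.IH
    by (simp add: distrib_left distrib_right scaleC_mult_left scaleC_mult_right)
qed simp

text \<open>Since \<open>\<phi>\<^sup>k\<close> maps into the commutant of the core of level \<open>k\<close>, conjugation by \<open>u\<^sub>r\<close> has the
  same effect on that core for all \<open>r \<ge> k\<close>.\<close>

lemma cocyc_conj_core:
  assumes u: "unitary u" and x: "x \<in> cuntz_core n R k" and "k \<le> r"
  shows "cc u r * x * star (cc u r) = cc u k * x * star (cc u k)"
proof -
  define v where "v = (\<phi> ^^ k) (cc u (r - k))"
  have "unitary v" using u by (simp add: v_def shift_pow_unitary cocyc_unitary)
  have r: "cc u r = cc u k * v" using cocyc_add[of u k "r - k"] \<open>k \<le> r\<close> by (simp add: v_def)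
  have "v * x * star v = x"
    using shift_pow_commutes_core[OF x, of "cc u (r - k)"] \<open>unitary v\<close>
    by (simp add: v_def unitary_def mult.assoc)
  then show ?thesis by (simp add: r star_mult) (metis mult.assoc)
qed

text \<open>By \<open>R i a = \<phi> (a) R i\<close>, the factors \<open>u\<^sup>*\<close> between the letters move to the left, where they
  form the cocycle.\<close>

lemma word_perturbed:
  "set \<alpha> \<subseteq> {1..n} \<Longrightarrow> word_isom (\<lambda>i. star u * R i) \<alpha> = cc u (length \<alpha>) * W \<alpha>"
proof (induction \<alpha>)
  case (Cons i \<alpha>)
  have "word_isom (\<lambda>i. star u * R i) (i # \<alpha>) = star u * (R i * cc u (length \<alpha>)) * W \<alpha>"
    using Cons by (simp add: word_isom_def mult.assoc)
  also have "\<dots> = star u * (\<phi> (cc u (length \<alpha>)) * R i) * W \<alpha>"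
    using Cons.prems by (simp add: shift_generator)
  finally show ?case by (simp add: cocyc_Suc mult.assoc)
qed (simp add: word_isom_def cocyc_0)

lemma cuntz_family_perturbed:
  assumes "unitary u"
  shows "cuntz_family n (\<lambda>i. star u * R i)"
proof
  fix i assume i: "i \<in> {1..n}"
  have "star (star u * R i) * (star u * R i) = star (R i) * (u * star u) * R i"
    by (simp add: star_mult mult.assoc)
  then show "star (star u * R i) * (star u * R i) = 1"
    using assms isometry[OF i] by (simp add: unitary_def)
next
  have "(\<Sum>i=1..n. star u * R i * star (star u * R i)) = star u * (\<Sum>i=1..n. R i * star (R i)) * u"
    by (simp add: sum_distrib_left sum_distrib_right star_mult mult.assoc)
  then show "(\<Sum>i=1..n. star u * R i * star (star u * R i)) = 1"
    using assms range_sum by (simp add: unitary_def)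
qed (rule two_le)

end

section \<open>Formal linear combinations of word monomials\<close>

text \<open>A list of triples \<open>(c, \<alpha>, \<beta>)\<close> is a formal sum of terms \<open>c R\<^sub>\<alpha> R\<^sub>\<beta>\<^sup>*\<close>. It can be
  evaluated in several families of isometries at once, which allows comparing them before any
  homomorphism between the generated algebras is known to exist.\<close>

type_synonym word_term = "complex \<times> nat list \<times> nat list"

fun word_monomial :: "(nat \<Rightarrow> 'a::cstar_algebra) \<Rightarrow> word_term \<Rightarrow> 'a" where
  "word_monomial R (c, \<alpha>, \<beta>) = c *\<^sub>C (word_isom R \<alpha> * star (word_isom R \<beta>))"

fun degr :: "word_term \<Rightarrow> int" where
  "degr (c, \<alpha>, \<beta>) = int (length \<alpha>) - int (length \<beta>)"

fun letters :: "word_term \<Rightarrow> nat set" where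
  "letters (c, \<alpha>, \<beta>) = set \<alpha> \<union> set \<beta>"

definition ev :: "(nat \<Rightarrow> 'a::cstar_algebra) \<Rightarrow> word_term list \<Rightarrow> 'a" where
  "ev R L = sum_list (map (word_monomial R) L)"

definition degree_part :: "int \<Rightarrow> word_term list \<Rightarrow> word_term list" where
  "degree_part j L = filter (\<lambda>t. degr t = j) L"

lemma ev_Nil [simp]: "ev R [] = 0"
  and ev_Cons [simp]: "ev R (t # L) = word_monomial R t + ev R L"
  and ev_append: "ev R (L @ M) = ev R L + ev R M"
  by (simp_all add: ev_def)

lemma degree_part_simps [simp]:
  "degree_part j [] = []"
  "degree_part j (t # L) = (if degr t = j then t # degree_part j L else degree_part j L)"
  by (simp_all add: degree_part_def)

lemma set_degree_part [simp]: "set (degree_part j L) = {t \<in> set L. degr t = j}"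
  by (simp add: degree_part_def)

lemma ev_sum_degree_parts:
  "\<forall>t\<in>set L. \<bar>degr t\<bar> \<le> int d \<Longrightarrow> ev R L = (\<Sum>j=-int d..int d. ev R (degree_part j L))"
proof (induction L)
  case (Cons t L)
  have "(\<Sum>j=-int d..int d. ev R (degree_part j (t # L))) =
      (\<Sum>j=-int d..int d. (if j = degr t then word_monomial R t else 0) + ev R (degree_part j L))"
    by (intro sum.cong) auto
  then show ?case using Cons by (simp add: sum.distrib abs_le_iff)
qed simp

text \<open>Padding both words by powers of the first generator shifts the degree and corresponds to
  multiplication by isometries from the outside.\<close>

fun pad :: "nat \<Rightarrow> nat \<Rightarrow> word_term \<Rightarrow> word_term" where
  "pad p q (c, \<alpha>, \<beta>) = (c, replicate p 1 @ \<alpha>, replicate q 1 @ \<beta>)"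

lemma degr_pad: "degr (pad p q t) = degr t + int p - int q"
  by (cases t) simp

lemma degree_part_0_pad:
  "degree_part 0 (map (pad (nat (- j)) (nat j)) L) = map (pad (nat (- j)) (nat j)) (degree_part j L)"
  by (induction L) (auto simp: degr_pad)

context cuntz_family
begin

lemma letters_pad: "letters t \<subseteq> {1..n} \<Longrightarrow> letters (pad p q t) \<subseteq> {1..n}"
  using two_le by (cases t) auto

lemma ev_pad:
  "ev R (map (pad p q) L) = W (replicate p 1) * ev R L * star (W (replicate q 1))"
proof (induction L)
  case (Cons t L)
  then show ?case
    by (cases t) (simp add: word_append star_mult scaleC_mult_left scaleC_mult_right
        distrib_left distrib_right mult.assoc)
qed simp

lemma norm_ev_pad: "norm (ev R (map (pad p q) L)) = norm (ev R L)"
proof -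
  have "star (W (replicate m 1)) * W (replicate m 1) = 1" for m
    using two_le by (intro word_isometry) auto
  then show ?thesis by (simp add: ev_pad norm_isometry_mult norm_mult_star_isometry)
qed

text \<open>Cuntz's compression. With \<open>g = R\<^sub>1\<^sup>k R\<^sub>2\<close>, the isometry \<open>w = \<phi>\<^sup>k (g)\<close> commutes past words of length
  at most \<open>k\<close>, except that the exponent of \<open>\<phi>\<close> drops by the length. A monomial of nonzero degree
  leaves two different exponents \<open>p, q \<le> k\<close>, and \<open>\<phi>\<^sup>p (g)\<close> and \<open>\<phi>\<^sup>q (g)\<close> have orthogonal ranges because the
  word \<open>1\<^sup>k 2\<close> does not agree with any shift of itself by 1 to \<open>k\<close> letters.\<close>

lemma degree_0_compression:
  assumes "\<forall>t\<in>set L. letters t \<subseteq> {1..n}"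
  obtains w where "star w * w = 1" "star w * ev R L * w = ev R (degree_part 0 L)"
proof -
  define k where "k = sum_list (map (\<lambda>(c, \<alpha>, \<beta>). length \<alpha> + length \<beta>) L)"
  have len: "length \<alpha> \<le> k \<and> length \<beta> \<le> k" if "(c, \<alpha>, \<beta>) \<in> set L" for c \<alpha> \<beta>
    using member_le_sum_list[of "length \<alpha> + length \<beta>" "map (\<lambda>(c, \<alpha>, \<beta>). length \<alpha> + length \<beta>) L"] that
    by (force simp: k_def)
  define g where "g = W (replicate k 1 @ [2])"
  have g1: "star g * g = 1" unfolding g_def using two_le by (intro word_isometry) auto
  have g0: "star g * (\<phi> ^^ q) g = 0" if "0 < q" "q \<le> k" for q
  proof -
    let ?s = "W (replicate q 1)" and ?t = "W (replicate (k - q) 1)"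
    have rep: "replicate k 1 = replicate q 1 @ replicate (k - q) (1::nat)"
      "replicate k 1 = replicate (k - q) 1 @ replicate q (1::nat)"
      using that by (simp_all add: replicate_add[symmetric])
    have g: "g = ?s * (?t * R 2)" "g = ?t * (?s * R 2)"
      unfolding g_def by (subst rep, simp add: word_append mult.assoc)+
    have t: "star ?t * ?t = 1" using two_le by (intro word_isometry) auto
    have s: "star ?s * (\<phi> ^^ q) g = g * star ?s"
    proof -
      have "set (replicate q 1) \<subseteq> {1..n}" using two_le by auto
      from star_word_shift[OF this, of q g] show ?thesis by simp
    qed
    have "?s = R 1 * W (replicate (q - 1) 1)" using that by (cases q) auto
    then have R2: "star (R 2) * ?s = 0"
      using two_le by (simp add: orthogonal mult.assoc[symmetric])
    have "star g * (\<phi> ^^ q) g = star (R 2) * star ?t * (star ?s * (\<phi> ^^ q) g)"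
      by (subst (1) g(1)) (simp add: star_mult mult.assoc)
    also have "\<dots> = star (R 2) * (star ?t * ?t) * ?s * (R 2 * star ?s)"
      unfolding s by (subst (1) g(2)) (simp add: mult.assoc)
    also have "\<dots> = star (R 2) * ?s * (R 2 * star ?s)" by (simp only: t mult_1_right)
    finally show ?thesis by (simp only: R2 mult_zero_left)
  qed
  have cross: "star ((\<phi> ^^ p) g) * (\<phi> ^^ q) g = (if p = q then 1 else 0)"
    if "p \<le> k" "q \<le> k" for p q
  proof -
    have less: "star ((\<phi> ^^ p) g) * (\<phi> ^^ q) g = 0" if "p < q" "q \<le> k" for p q
    proof -
      have "star ((\<phi> ^^ p) g) * (\<phi> ^^ (p + (q - p))) g = (\<phi> ^^ p) (star g * (\<phi> ^^ (q - p)) g)"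
        by (simp add: funpow_add shift_pow_mult shift_pow_star)
      then show ?thesis using that by (simp add: g0 shift_pow_0)
    qed
    show ?thesis
    proof (cases p q rule: linorder_cases)
      case equal
      then show ?thesis using g1
        by (simp add: shift_pow_star[symmetric] shift_pow_mult[symmetric] shift_pow_1)
    next
      case greater
      then show ?thesis using arg_cong[OF less[of q p], of star] that by (simp add: star_mult)
    qed (use less that in simp)
  qed
  define w where "w = (\<phi> ^^ k) g"
  have compressed: "star w * word_monomial R t * w = (if degr t = 0 then word_monomial R t else 0)" if "t \<in> set L" for t
  proof -
    obtain c \<alpha> \<beta> where t: "t = (c, \<alpha>, \<beta>)" by (cases t)
    then have ab: "set \<alpha> \<subseteq> {1..n}" "length \<alpha> \<le> k" "set \<beta> \<subseteq> {1..n}" "length \<beta> \<le> k"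
      using bspec[OF assms that] len[of c \<alpha> \<beta>] that by auto
    have "star w * (W \<alpha> * star (W \<beta>)) * w = star (star (W \<alpha>) * w) * (star (W \<beta>) * w)"
      by (simp add: star_mult mult.assoc)
    also have "\<dots> = W \<alpha> * (star ((\<phi> ^^ (k - length \<alpha>)) g) * (\<phi> ^^ (k - length \<beta>)) g) * star (W \<beta>)"
      using ab by (simp add: w_def star_word_shift star_mult mult.assoc)
    also have "star ((\<phi> ^^ (k - length \<alpha>)) g) * (\<phi> ^^ (k - length \<beta>)) g =
        (if length \<alpha> = length \<beta> then 1 else 0)"
      using cross[of "k - length \<alpha>" "k - length \<beta>"] ab by auto
    finally show ?thesis
      by (auto simp: t scaleC_mult_left scaleC_mult_right)
  qed
  have "star w * ev R M * w = ev R (degree_part 0 M)" if "set M \<subseteq> set L" for M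
    using that by (induction M) (auto simp: compressed distrib_left distrib_right)
  moreover have "star w * w = 1"
    using cross[of k k] by (simp add: w_def)
  ultimately show ?thesis using that by blast
qed

text \<open>Padding moves the part of degree \<open>j\<close> into degree 0 without changing its norm, and the
  isometry of the compression removes everything else.\<close>

lemma norm_degree_part_le:
  assumes "\<forall>t\<in>set L. letters t \<subseteq> {1..n}"
  shows "norm (ev R (degree_part j L)) \<le> norm (ev R L)"
proof -
  let ?L = "map (pad (nat (- j)) (nat j)) L"
  have "\<forall>t\<in>set ?L. letters t \<subseteq> {1..n}" using assms letters_pad by auto
  then obtain w where w: "star w * w = 1" "star w * ev R ?L * w = ev R (degree_part 0 ?L)"
    by (rule degree_0_compression)
  have "norm (ev R (degree_part 0 ?L)) \<le> norm (ev R ?L)"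
    using norm_compress_le[OF w(1), of "ev R ?L"] w(2) by simp
  then show ?thesis by (simp add: degree_part_0_pad norm_ev_pad)
qed

end

section \<open>Comparing two families of isometries\<close>

text \<open>Equal norms in degree 0 force equal norms of all formal sums, so the comparison only has to
  be established there.\<close>

locale cuntz_pair = R: cuntz_family n R + T: cuntz_family n T
  for n and R T :: "nat \<Rightarrow> 'a::cstar_algebra" +
  assumes norm_degree_0: "\<And>L. \<forall>t\<in>set L. letters t \<subseteq> {1..n} \<Longrightarrow> \<forall>t\<in>set L. degr t = 0 \<Longrightarrow>
    norm (ev T L) = norm (ev R L)"
begin

text \<open>The graph of the homomorphism \<open>R i \<mapsto> T i\<close> on the dense subalgebra, introduced as a relation
  because it is not yet known to be single-valued. It is filtered by degree for the sake of the
  norm estimates.\<close>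

definition rel :: "nat \<Rightarrow> 'a \<Rightarrow> 'a \<Rightarrow> bool" where
  "rel d x y \<longleftrightarrow> (\<exists>L. (\<forall>t\<in>set L. letters t \<subseteq> {1..n} \<and> \<bar>degr t\<bar> \<le> int d) \<and> x = ev R L \<and> y = ev T L)"

lemma rel_norm_bound:
  assumes "rel d x y"
  shows "norm y \<le> (2 * real d + 1) * norm x"
proof -
  obtain L where L: "\<forall>t\<in>set L. letters t \<subseteq> {1..n}" "\<forall>t\<in>set L. \<bar>degr t\<bar> \<le> int d"
      "x = ev R L" "y = ev T L"
    using assms by (auto simp: rel_def)
  have "norm (ev T (degree_part j L)) \<le> norm x" for j
  proof -
    let ?M = "map (pad (nat (- j)) (nat j)) (degree_part j L)"
    have "norm (ev T ?M) = norm (ev R ?M)"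
      using L(1) R.letters_pad by (intro norm_degree_0) (auto simp: degr_pad)
    then show ?thesis
      using R.norm_degree_part_le[OF L(1), of j] L(3) by (simp add: R.norm_ev_pad T.norm_ev_pad)
  qed
  then have "norm (\<Sum>j=-int d..int d. ev T (degree_part j L)) \<le> (\<Sum>j=-int d..int d. norm x)"
    by (intro sum_norm_le)
  then show ?thesis
    using ev_sum_degree_parts[OF L(2), of T] L(4) by simp
qed

lemma rel_monomial:
  assumes "letters t \<subseteq> {1..n}" "\<bar>degr t\<bar> \<le> int d"
  shows "rel d (word_monomial R t) (word_monomial T t)"
  unfolding rel_def by (rule exI[of _ "[t]"]) (use assms in simp)

lemma rel_0: "rel d 0 0"
  unfolding rel_def by (rule exI[of _ "[]"]) simp

lemma rel_weaken: "rel d x y \<Longrightarrow> d \<le> e \<Longrightarrow> rel e x y"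
  unfolding rel_def by force

lemma rel_add:
  assumes "rel d x y" "rel d x' y'"
  shows "rel d (x + x') (y + y')"
proof -
  obtain L M where "\<forall>t\<in>set L. letters t \<subseteq> {1..n} \<and> \<bar>degr t\<bar> \<le> int d" "x = ev R L" "y = ev T L"
    "\<forall>t\<in>set M. letters t \<subseteq> {1..n} \<and> \<bar>degr t\<bar> \<le> int d" "x' = ev R M" "y' = ev T M"
    using assms by (auto simp: rel_def)
  then show ?thesis unfolding rel_def
    by (intro exI[of _ "L @ M"]) (auto simp: ev_append)
qed

lemma rel_sum_list:
  "(\<And>t. t \<in> set L \<Longrightarrow> rel d (f t) (g t)) \<Longrightarrow> rel d (sum_list (map f L)) (sum_list (map g L))"
  by (induction L) (auto simp: rel_0 intro: rel_add)

lemma rel_star: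
  assumes "rel d x y"
  shows "rel d (star x) (star y)"
proof -
  obtain L where L: "\<forall>t\<in>set L. letters t \<subseteq> {1..n} \<and> \<bar>degr t\<bar> \<le> int d" "x = ev R L" "y = ev T L"
    using assms by (auto simp: rel_def)
  have ev: "star (ev Q L) = sum_list (map (\<lambda>t. star (word_monomial Q t)) L)" for Q :: "nat \<Rightarrow> 'a"
    by (induction L) (simp_all add: star_add)
  have "rel d (star (word_monomial R t)) (star (word_monomial T t))" if "t \<in> set L" for t
  proof -
    obtain c \<alpha> \<beta> where t: "t = (c, \<alpha>, \<beta>)" by (cases t)
    then have "star (word_monomial Q t) = word_monomial Q (cnj c, \<beta>, \<alpha>)" for Q :: "nat \<Rightarrow> 'a"
      by (simp add: star_scaleC star_mult)
    moreover have "rel d (word_monomial R (cnj c, \<beta>, \<alpha>)) (word_monomial T (cnj c, \<beta>, \<alpha>))"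
      using L(1) that t by (intro rel_monomial) force+
    ultimately show ?thesis by simp
  qed
  then show ?thesis unfolding L(2,3) ev by (rule rel_sum_list)
qed

lemma rel_monomial_mult:
  assumes s: "letters s \<subseteq> {1..n}" "\<bar>degr s\<bar> \<le> int d" and t: "letters t \<subseteq> {1..n}" "\<bar>degr t\<bar> \<le> int e"
  shows "rel (d + e) (word_monomial R s * word_monomial R t) (word_monomial T s * word_monomial T t)"
proof -
  obtain a \<alpha> \<beta> b \<gamma> \<delta> where st: "s = (a, \<alpha>, \<beta>)" "t = (b, \<gamma>, \<delta>)" by (cases s, cases t)
  have sets: "set \<beta> \<subseteq> {1..n}" "set \<gamma> \<subseteq> {1..n}" using s t st by auto
  have prod: "word_monomial Q s * word_monomial Q t =
      (a * b) *\<^sub>C (word_isom Q \<alpha> * (star (word_isom Q \<beta>) * word_isom Q \<gamma>) * star (word_isom Q \<delta>))"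
    for Q :: "nat \<Rightarrow> 'a"
    by (simp add: st scaleC_mult_left scaleC_mult_right scaleC_scaleC mult.assoc)
  consider \<rho> where "\<gamma> = \<beta> @ \<rho>" | \<rho> where "\<beta> = \<gamma> @ \<rho>"
    | "take (length \<beta>) \<gamma> \<noteq> \<beta>" "take (length \<gamma>) \<beta> \<noteq> \<gamma>"
    by (metis append_take_drop_id)
  then show ?thesis
  proof cases
    case 1
    have "word_monomial Q s * word_monomial Q t = word_monomial Q (a * b, \<alpha> @ \<rho>, \<delta>)"
      if "cuntz_family n Q" for Q :: "nat \<Rightarrow> 'a"
      using cuntz_family.star_word_mult[OF that sets] 1 cuntz_family.word_append[OF that]
      by (simp add: prod)
    note eq = this[OF R.cuntz_family_axioms] this[OF T.cuntz_family_axioms]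
    show ?thesis unfolding eq by (rule rel_monomial) (use s t st 1 in auto)
  next
    case 2
    have "word_monomial Q s * word_monomial Q t = word_monomial Q (a * b, \<alpha>, \<delta> @ \<rho>)"
      if "cuntz_family n Q" for Q :: "nat \<Rightarrow> 'a"
    proof -
      have "star (word_isom Q \<beta>) * word_isom Q \<gamma> = star (word_isom Q \<rho>)"
        using cuntz_family.star_word_mult[OF that sets] 2 cuntz_family.word_Nil[OF that]
        by (auto split: if_splits)
      then show ?thesis using cuntz_family.word_append[OF that]
        by (simp add: prod star_mult mult.assoc)
    qed
    note eq = this[OF R.cuntz_family_axioms] this[OF T.cuntz_family_axioms]
    show ?thesis unfolding eq by (rule rel_monomial) (use s t st 2 in auto)
  next
    case 3
    then show ?thesis
      using R.star_word_mult[OF sets] T.star_word_mult[OF sets] by (simp add: prod rel_0)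
  qed
qed

lemma rel_mult:
  assumes "rel d x y" "rel e x' y'"
  shows "rel (d + e) (x * x') (y * y')"
proof -
  obtain L M where L: "\<forall>t\<in>set L. letters t \<subseteq> {1..n} \<and> \<bar>degr t\<bar> \<le> int d" "x = ev R L" "y = ev T L"
    and M: "\<forall>t\<in>set M. letters t \<subseteq> {1..n} \<and> \<bar>degr t\<bar> \<le> int e" "x' = ev R M" "y' = ev T M"
    using assms by (auto simp: rel_def)
  have prod: "ev Q L * ev Q M = sum_list (map (\<lambda>s. sum_list (map (\<lambda>t. word_monomial Q s * word_monomial Q t) M)) L)"
    for Q :: "nat \<Rightarrow> 'a"
    by (induction L) (simp_all add: ev_def distrib_right sum_list_const_mult)
  show ?thesis unfolding L(2,3) M(2,3) prod
    using L(1) M(1) by (intro rel_sum_list rel_monomial_mult) blast+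
qed

lemma rel_1: "rel d 1 1"
  using rel_monomial[of "(1, [], [])" d] by simp

lemma rel_scaleC: "rel d x y \<Longrightarrow> rel d (c *\<^sub>C x) (c *\<^sub>C y)"
  using rel_mult[OF rel_monomial[of "(c, [], [])" 0]] by (simp add: scaleC_mult_left)

lemma rel_generator: "i \<in> {1..n} \<Longrightarrow> rel 1 (R i) (T i)"
  using rel_monomial[of "(1, [i], [])" 1] by simp

lemma rel_power: "rel d x y \<Longrightarrow> rel (m * d) (x ^ m) (y ^ m)"
  by (induction m) (auto simp: rel_1 intro: rel_mult)

text \<open>The degree of \<open>(x\<^sup>* x)\<^sup>N\<close> grows linearly in \<open>N\<close>, hence so does the factor in the norm bound,
  whereas both norms are \<open>2 N\<close>-th powers. Taking roots removes the factor.\<close>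

lemma rel_contractive:
  assumes xy: "rel d x y"
  shows "norm y \<le> norm x"
proof (rule ccontr)
  assume "\<not> norm y \<le> norm x"
  then have less: "norm x < norm y" by simp
  have bound: "norm y ^ (2 * 2 ^ m) \<le> (2 * real (2 ^ m * (d + d)) + 1) * norm x ^ (2 * 2 ^ m)" for m
  proof -
    have "rel (2 ^ m * (d + d)) ((star x * x) ^ 2 ^ m) ((star y * y) ^ 2 ^ m)"
      by (intro rel_power rel_mult rel_star xy)
    then have "norm ((star y * y) ^ 2 ^ m)
        \<le> (2 * real (2 ^ m * (d + d)) + 1) * norm ((star x * x) ^ 2 ^ m)"
      by (rule rel_norm_bound)
    then show ?thesis
      using norm_selfadjoint_power[of "star x * x" m] norm_selfadjoint_power[of "star y * y" m]
      by (simp add: star_mult cstar_identity power_mult)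
  qed
  have x: "norm x > 0" using bound[of 0] less by (cases "x = 0") auto
  define a where "a = norm y / norm x"
  have a: "a > 1" using x less by (simp add: a_def)
  have le: "a ^ (2 * 2 ^ m) \<le> 4 * real d * 2 ^ m + 1" for m
    using bound[of m] x by (simp add: a_def power_divide field_simps)
  have "(\<lambda>N. real N * (1 / a) ^ N) \<longlonglongrightarrow> 0"
    using a by (intro powser_times_n_limit_0) auto
  moreover have "filterlim (\<lambda>m. 2 * 2 ^ m :: nat) at_top sequentially"
    by (rule filterlim_subseq) (simp add: strict_mono_def)
  ultimately have "(\<lambda>m. real (2 * 2 ^ m) * (1 / a) ^ (2 * 2 ^ m)) \<longlonglongrightarrow> 0"
    by (rule filterlim_compose)
  then have lim: "(\<lambda>m. (4 * real d + 1) * (real (2 * 2 ^ m) * (1 / a) ^ (2 * 2 ^ m))) \<longlonglongrightarrow> (4 * real d + 1) * 0"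
    by (intro tendsto_mult tendsto_const)
  have "1 \<le> (4 * real d + 1) * (real (2 * 2 ^ m) * (1 / a) ^ (2 * 2 ^ m))" for m
  proof -
    have "4 * real d * 2 ^ m + 1 \<le> (4 * real d + 1) * real (2 * 2 ^ m)"
    proof -
      have "0 \<le> real d * 2 ^ m" "1 \<le> (2::real) ^ m" by simp_all
      moreover have "(4 * real d + 1) * real (2 * 2 ^ m) = 8 * (real d * 2 ^ m) + 2 * 2 ^ m"
        by (simp add: algebra_simps)
      ultimately show ?thesis by linarith
    qed
    then have "a ^ (2 * 2 ^ m) \<le> (4 * real d + 1) * real (2 * 2 ^ m)"
      using le[of m] by linarith
    then show ?thesis using a by (simp add: power_one_over field_simps)
  qed
  then have "(1::real) \<le> (4 * real d + 1) * 0"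
    using LIMSEQ_le_const[OF lim] by blast
  then show False by simp
qed

lemma swap: "cuntz_pair n T R"
  by unfold_locales (simp add: norm_degree_0)

lemma rel_isometric: "rel d x y \<Longrightarrow> norm y = norm x"
proof (rule antisym)
  interpret swapped: cuntz_pair n T R by (rule swap)
  assume xy: "rel d x y"
  then have "swapped.rel d y x" unfolding rel_def swapped.rel_def by blast
  then show "norm x \<le> norm y" by (rule swapped.rel_contractive)
qed (rule rel_contractive)

end

section \<open>The endomorphism determined by a unitary\<close>

lemma cstar_subalgebra_closure:
  fixes P :: "'a::cstar_algebra set"
  assumes one: "1 \<in> P" and add: "\<And>x y. x \<in> P \<Longrightarrow> y \<in> P \<Longrightarrow> x + y \<in> P"
    and mult: "\<And>x y. x \<in> P \<Longrightarrow> y \<in> P \<Longrightarrow> x * y \<in> P"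
    and scale: "\<And>c x. x \<in> P \<Longrightarrow> c *\<^sub>C x \<in> P" and st: "\<And>x. x \<in> P \<Longrightarrow> star x \<in> P"
  shows "cstar_subalgebra (closure P)"
  unfolding cstar_subalgebra_def
proof (intro conjI ballI allI)
  show "1 \<in> closure P" using one closure_subset by blast
next
  fix x y assume "x \<in> closure P" "y \<in> closure P"
  then obtain X Y where X: "\<And>m. X m \<in> P" "X \<longlonglongrightarrow> x" and Y: "\<And>m. Y m \<in> P" "Y \<longlonglongrightarrow> y"
    unfolding closure_sequential by blast
  have "(\<lambda>m. X m + Y m) \<longlonglongrightarrow> x + y" "(\<lambda>m. X m * Y m) \<longlonglongrightarrow> x * y"
    by (intro tendsto_intros X Y)+
  moreover have "\<forall>m. X m + Y m \<in> P" "\<forall>m. X m * Y m \<in> P"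
    using add[OF X(1) Y(1)] mult[OF X(1) Y(1)] by blast+
  ultimately show "x + y \<in> closure P" "x * y \<in> closure P"
    unfolding closure_sequential by (auto intro: exI[of _ "\<lambda>m. X m + Y m"] exI[of _ "\<lambda>m. X m * Y m"])
next
  fix x c assume "x \<in> closure P"
  then obtain X where X: "\<And>m. X m \<in> P" "X \<longlonglongrightarrow> x"
    unfolding closure_sequential by blast
  have "\<forall>m. c *\<^sub>C X m \<in> P" "\<forall>m. star (X m) \<in> P"
    using scale[OF X(1)] st[OF X(1)] by blast+
  then show "c *\<^sub>C x \<in> closure P" "star x \<in> closure P"
    unfolding closure_sequential using tendsto_scaleC[OF X(2), of c] tendsto_star[OF X(2)]
    by (auto intro: exI[of _ "\<lambda>m. c *\<^sub>C X m"] exI[of _ "\<lambda>m. star (X m)"])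
qed simp

context cuntz_pair
begin

text \<open>Formal sums with equal values in \<open>R\<close> have equal values in \<open>T\<close> because the comparison
  is isometric. The resulting map is defined on a dense \<^emph>\<open>*\<close>-subalgebra.\<close>

lemma isometric_endomorphism:
  assumes gen: "cstar_subalgebra hull (R ` {1..n}) = UNIV"
  obtains f where "unital_star_endomorphism f" "\<And>x. norm (f x) = norm x"
    "\<And>i. i \<in> {1..n} \<Longrightarrow> f (R i) = T i"
proof -
  define P where "P = {x. \<exists>d y. rel d x y}"
  define f where "f x = (SOME y. \<exists>d. rel d x y)" for x
  have diff: "norm (y - y') = norm (x - x')" if "rel d x y" "rel e x' y'" for d e x y x' y'
  proof -
    have m: "(-1) *\<^sub>C z = - z" for z :: 'a
      using scaleC_of_real[of "-1" z] by simp
    have "rel (d + e) x y" "rel (d + e) ((-1) *\<^sub>C x') ((-1) *\<^sub>C y')"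
      by (rule rel_weaken[OF that(1)], simp) (rule rel_weaken[OF rel_scaleC[OF that(2)]], simp)
    from rel_isometric[OF rel_add[OF this]] show ?thesis by (simp add: m)
  qed
  have f_eq: "f x = y" if "rel d x y" for d x y
  proof -
    have "\<exists>d. rel d x (f x)" unfolding f_def by (rule someI_ex) (use that in blast)
    then show ?thesis using diff[OF _ that, of _ x "f x"] by auto
  qed
  have P_rel: "\<exists>d. rel d x (f x)" if "x \<in> P" for x
    using that f_eq unfolding P_def by blast
  have P_add: "x + y \<in> P" "f (x + y) = f x + f y"
    and P_mult: "x * y \<in> P" "f (x * y) = f x * f y" if xy: "x \<in> P" "y \<in> P" for x y
  proof -
    obtain d e where d: "rel d x (f x)" and e: "rel e y (f y)" using P_rel xy by blast
    have "rel (d + e) x (f x)" "rel (d + e) y (f y)"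
      using rel_weaken[OF d] rel_weaken[OF e] by simp_all
    then have "rel (d + e) (x + y) (f x + f y)" by (rule rel_add)
    moreover have "rel (d + e) (x * y) (f x * f y)" using d e by (rule rel_mult)
    ultimately show "x + y \<in> P" "f (x + y) = f x + f y" "x * y \<in> P" "f (x * y) = f x * f y"
      using f_eq unfolding P_def by blast+
  qed
  have P_scale: "c *\<^sub>C x \<in> P" "f (c *\<^sub>C x) = c *\<^sub>C f x"
    and P_star: "star x \<in> P" "f (star x) = star (f x)" if x: "x \<in> P" for x c
  proof -
    obtain d where d: "rel d x (f x)" using P_rel[OF x] by blast
    show "c *\<^sub>C x \<in> P" "f (c *\<^sub>C x) = c *\<^sub>C f x" "star x \<in> P" "f (star x) = star (f x)"
      using f_eq[OF rel_scaleC[OF d, of c]] f_eq[OF rel_star[OF d]] rel_scaleC[OF d] rel_star[OF d]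
      unfolding P_def by blast+
  qed
  have P_1: "1 \<in> P" "f 1 = 1" using rel_1 f_eq unfolding P_def by blast+
  have "cstar_subalgebra (closure P)"
    by (intro cstar_subalgebra_closure P_1 P_add P_mult P_scale P_star)
  moreover have gens: "R i \<in> P" "f (R i) = T i" if "i \<in> {1..n}" for i
    using rel_generator[OF that] f_eq unfolding P_def by blast+
  then have "R ` {1..n} \<subseteq> closure P" using closure_subset by blast
  ultimately have dense: "closure P = UNIV" using hull_minimal gen by blast
  have "dist (f x) (f y) = dist x y" if "x \<in> P" "y \<in> P" for x y
    using diff P_rel that by (metis dist_norm)
  then have "uniformly_continuous_on P f"
    unfolding uniformly_continuous_on_def by metis
  then obtain g where "uniformly_continuous_on UNIV g" and gf: "\<And>x. x \<in> P \<Longrightarrow> f x = g x"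
    using uniformly_continuous_on_extension_on_closure[of P f] dense by metis
  then have g_cont: "continuous_on UNIV g" by (blast intro: uniformly_continuous_imp_continuous)
  have g_lim: "(\<lambda>m. g (X m)) \<longlonglongrightarrow> g x" if "X \<longlonglongrightarrow> x" for X x
    using continuous_on_tendsto_compose[OF g_cont that] by simp
  have approx: "\<exists>X. (\<forall>m. X m \<in> P) \<and> X \<longlonglongrightarrow> x" for x
    using dense closure_sequential[of x P] by simp
  have g_add: "g (x + y) = g x + g y" and g_mult: "g (x * y) = g x * g y" for x y
  proof -
    obtain X Y where X: "\<And>m. X m \<in> P" "X \<longlonglongrightarrow> x" and Y: "\<And>m. Y m \<in> P" "Y \<longlonglongrightarrow> y"
      using approx[of x] approx[of y] by auto
    have "g (X m + Y m) = g (X m) + g (Y m)" "g (X m * Y m) = g (X m) * g (Y m)" for m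
      using P_add[OF X(1)[of m] Y(1)[of m]] P_mult[OF X(1)[of m] Y(1)[of m]] X(1)[of m] Y(1)[of m]
      by (simp_all add: gf[symmetric])
    then show "g (x + y) = g x + g y" "g (x * y) = g x * g y"
      using tendsto_add[OF g_lim[OF X(2)] g_lim[OF Y(2)]] g_lim[OF tendsto_add[OF X(2) Y(2)]]
        tendsto_mult[OF g_lim[OF X(2)] g_lim[OF Y(2)]] g_lim[OF tendsto_mult[OF X(2) Y(2)]]
        LIMSEQ_unique by auto
  qed
  have g_scale: "g (c *\<^sub>C x) = c *\<^sub>C g x" and g_star: "g (star x) = star (g x)"
    and g_norm: "norm (g x) = norm x" for c x
  proof -
    obtain X where X: "\<And>m. X m \<in> P" "X \<longlonglongrightarrow> x"
      using approx[of x] by auto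
    have "g (c *\<^sub>C X m) = c *\<^sub>C g (X m)" "g (star (X m)) = star (g (X m))"
      "norm (g (X m)) = norm (X m)" for m
      using P_scale[OF X(1)[of m]] P_star[OF X(1)[of m]] X(1)[of m] P_rel[OF X(1)[of m]]
      by (auto simp: gf[symmetric] rel_isometric)
    then show "g (c *\<^sub>C x) = c *\<^sub>C g x" "g (star x) = star (g x)" "norm (g x) = norm x"
      using tendsto_scaleC[OF g_lim[OF X(2)], of c] g_lim[OF tendsto_scaleC[OF X(2), of c]]
        tendsto_star[OF g_lim[OF X(2)]] g_lim[OF tendsto_star[OF X(2)]]
        tendsto_norm[OF g_lim[OF X(2)]] tendsto_norm[OF X(2)]
        LIMSEQ_unique by auto
  qed
  have "unital_star_endomorphism g"
    unfolding unital_star_endomorphism_def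
    using P_1 gf g_add g_mult g_scale g_star by metis
  moreover have "g (R i) = T i" if "i \<in> {1..n}" for i
    using gens[OF that] gf by metis
  ultimately show ?thesis using that g_norm by blast
qed

end

text \<open>In a monomial of degree 0 both words have the same length \<open>l\<close>, so the perturbation puts \<open>u\<^sub>l\<close> on
  the left and \<open>u\<^sub>l\<^sup>*\<close> on the right. A single \<open>u\<^sub>k\<close> with large \<open>k\<close> serves all monomials of a formal
  sum, whose two values are therefore unitarily conjugate.\<close>

lemma (in cuntz_family) cuntz_pair_perturbed:
  assumes u: "unitary u"
  shows "cuntz_pair n R (\<lambda>i. star u * R i)"
proof (intro cuntz_pair.intro cuntz_pair_axioms.intro cuntz_family_perturbed[OF u] cuntz_family_axioms)
  fix L assume letters: "\<forall>t\<in>set L. letters t \<subseteq> {1..n}" and deg: "\<forall>t\<in>set L. degr t = 0"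
  let ?T = "\<lambda>i. star u * R i"
  define k where "k = sum_list (map (\<lambda>(c, \<alpha>, \<beta>). length \<alpha>) L)"
  have conj: "word_monomial ?T t = cc u k * word_monomial R t * star (cc u k)" if t: "t \<in> set L" for t
  proof -
    obtain c \<alpha> \<beta> where abc: "t = (c, \<alpha>, \<beta>)" by (cases t)
    have le: "length \<alpha> \<le> k"
      using member_le_sum_list[of "length \<alpha>" "map (\<lambda>(c, \<alpha>, \<beta>). length \<alpha>) L"] t abc
      by (force simp: k_def)
    have ab: "set \<alpha> \<subseteq> {1..n}" "set \<beta> \<subseteq> {1..n}" "length \<beta> = length \<alpha>"
      using letters deg t abc by force+
    define x where "x = W \<alpha> * star (W \<beta>)"
    have "x \<in> cuntz_core n R (length \<alpha>)"
      unfolding cuntz_core_def x_def using ab by (intro cvec.span_base) (auto simp: words_def)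
    then have "cc u k * x * star (cc u k) = cc u (length \<alpha>) * x * star (cc u (length \<alpha>))"
      by (rule cocyc_conj_core[OF u _ le])
    also have "\<dots> = word_isom ?T \<alpha> * star (word_isom ?T \<beta>)"
      using ab by (simp add: word_perturbed star_mult x_def mult.assoc)
    finally show ?thesis
      by (simp add: abc x_def scaleC_mult_left scaleC_mult_right)
  qed
  have "ev ?T M = cc u k * ev R M * star (cc u k)" if "set M \<subseteq> set L" for M
    using that by (induction M) (simp_all add: conj distrib_left distrib_right)
  then show "norm (ev ?T L) = norm (ev R L)"
    by (simp add: norm_unitary_conj cocyc_unitary u)
qed

locale cuntz_algebra = cuntz_family +
  assumes generated: "cstar_subalgebra hull (R ` {1..n}) = UNIV"
begin

text \<open>The equalizer of two endomorphisms is closed by automatic contractivity.\<close>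

lemma endomorphism_unique:
  assumes f: "unital_star_endomorphism f" and g: "unital_star_endomorphism g"
    and eq: "\<And>i. i \<in> {1..n} \<Longrightarrow> f (R i) = g (R i)"
  shows "f = g"
proof -
  have "closed {x. f x = g x}"
    using f g by (intro closed_Collect_eq star_endomorphism_continuous)
  then have "cstar_subalgebra {x. f x = g x}"
    using f g by (simp add: cstar_subalgebra_def unital_star_endomorphism_def)
  moreover have "R ` {1..n} \<subseteq> {x. f x = g x}" using eq by auto
  ultimately have "cstar_subalgebra hull (R ` {1..n}) \<subseteq> {x. f x = g x}"
    by (simp add: hull_minimal)
  then show ?thesis using generated by auto
qed

lemma induced_by_unique: "induced_by n R u f \<Longrightarrow> induced_by n R u g \<Longrightarrow> f = g"
  by (rule endomorphism_unique) (auto simp: induced_by_def)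

lemma induced_by_isometric:
  assumes "unitary u"
  obtains f where "induced_by n R u f" "\<And>x. norm (f x) = norm x"
proof (rule cuntz_pair.isometric_endomorphism[OF cuntz_pair_perturbed[OF assms] generated])
  fix f assume "unital_star_endomorphism f" "\<And>x. norm (f x) = norm x"
    "\<And>i. i \<in> {1..n} \<Longrightarrow> f (R i) = star u * R i"
  then show thesis by (intro that[of f]) (auto simp: induced_by_def)
qed

lemma ex1_induced_by: "unitary u \<Longrightarrow> \<exists>!f. induced_by n R u f"
  using induced_by_isometric induced_by_unique by metis

abbreviation endo :: "'a \<Rightarrow> 'a \<Rightarrow> 'a" where "endo \<equiv> cuntz_endo n R"

lemma induced_by_cuntz_endo: "unitary u \<Longrightarrow> induced_by n R u (endo u)"
  unfolding cuntz_endo_def using ex1_induced_by by (rule theI')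

lemma cuntz_endo_inj:
  assumes "unitary u"
  shows "inj (endo u)"
proof -
  obtain f where f: "induced_by n R u f" "\<And>x. norm (f x) = norm x"
    using induced_by_isometric[OF assms] by blast
  have "f = endo u" using induced_by_unique f(1) induced_by_cuntz_endo[OF assms] by blast
  moreover have "x = y" if "f x = f y" for x y
  proof -
    have "f x = f (x - y) + f y"
      using f(1) unfolding induced_by_def unital_star_endomorphism_def by (metis diff_add_cancel)
    then show ?thesis using that f(2)[of "x - y"] by simp
  qed
  ultimately show ?thesis by (auto intro: injI)
qed

lemma cuntz_endo_word:
  assumes u: "unitary u" and \<alpha>: "set \<alpha> \<subseteq> {1..n}"
  shows "endo u (W \<alpha>) = cc u (length \<alpha>) * W \<alpha>"
proof -
  have "endo u (W \<alpha>) = word_isom (\<lambda>i. star u * R i) \<alpha>"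
    using \<alpha> induced_by_cuntz_endo[OF u]
    by (induction \<alpha>) (auto simp: induced_by_def unital_star_endomorphism_def word_isom_def)
  then show ?thesis using word_perturbed[OF \<alpha>] by simp
qed

lemma cuntz_endo_core:
  assumes u: "unitary u" and x: "x \<in> cuntz_core n R k"
  shows "endo u x = cc u k * x * star (cc u k)"
proof -
  have e: "unital_star_endomorphism (endo u)"
    using induced_by_cuntz_endo[OF u] by (simp add: induced_by_def)
  then have add: "endo u (x + y) = endo u x + endo u y" and mult: "endo u (x * y) = endo u x * endo u y"
    and sc: "endo u (c *\<^sub>C x) = c *\<^sub>C endo u x" and st: "endo u (star x) = star (endo u x)" for x y c
    by (auto simp: unital_star_endomorphism_def)
  show ?thesis
    using x unfolding cuntz_core_def
  proof (induction rule: cvec.span_induct_alt)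
    case base
    show ?case using sc[of 0 0] by simp
  next
    case (step c x y)
    then obtain \<alpha> \<beta> where ab: "x = W \<alpha> * star (W \<beta>)" "\<alpha> \<in> words n k" "\<beta> \<in> words n k"
      by auto
    then have "endo u x = cc u k * x * star (cc u k)"
      by (simp add: mult st cuntz_endo_word u words_def star_mult mult.assoc)
    then show ?case using step.IH
      by (simp add: add sc distrib_left distrib_right scaleC_mult_left scaleC_mult_right)
  qed
qed

text \<open>If \<open>\<lambda>\<^sub>V\<close> maps \<open>U\<close> to \<open>V\<^sup>*\<close>, then \<open>\<lambda>\<^sub>V \<circ> \<lambda>\<^sub>U\<close> fixes the generators. Injectivity of \<open>\<lambda>\<^sub>V\<close> makes
  this one-sided inverse two-sided.\<close>

lemma cuntz_endo_inverse:
  assumes U: "unitary U" and V: "unitary V" and eq: "endo V U = star V"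
  shows "star_automorphism (endo U)" and "inv (endo U) = endo V"
proof -
  have eU: "unital_star_endomorphism (endo U)" and eV: "unital_star_endomorphism (endo V)"
    and gU: "\<And>i. i \<in> {1..n} \<Longrightarrow> endo U (R i) = star U * R i"
    and gV: "\<And>i. i \<in> {1..n} \<Longrightarrow> endo V (R i) = star V * R i"
    using induced_by_cuntz_endo[OF U] induced_by_cuntz_endo[OF V] by (auto simp: induced_by_def)
  have "endo V \<circ> endo U = id"
  proof (rule endomorphism_unique)
    show "unital_star_endomorphism (endo V \<circ> endo U)"
      using eU eV by (simp add: unital_star_endomorphism_def)
    show "unital_star_endomorphism (id :: 'a \<Rightarrow> 'a)"
      by (simp add: unital_star_endomorphism_def)
    fix i assume i: "i \<in> {1..n}"
    have "(endo V \<circ> endo U) (R i) = star (endo V U) * endo V (R i)"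
      using eV gU[OF i] by (simp add: unital_star_endomorphism_def)
    also have "\<dots> = (V * star V) * R i" by (simp add: eq gV[OF i] mult.assoc)
    finally show "(endo V \<circ> endo U) (R i) = id (R i)" using V by (simp add: unitary_def)
  qed
  then have left: "endo V (endo U x) = x" for x by (metis comp_apply id_apply)
  have right: "endo U (endo V x) = x" for x
    using cuntz_endo_inj[OF V] left[of "endo V x"] by (rule injD)
  show "star_automorphism (endo U)"
    unfolding star_automorphism_def using eU left right by (metis o_bij comp_apply id_apply ext)
  show "inv (endo U) = endo V" by (intro inv_equality left right)
qed

end

section \<open>The polynomial matrix equation\<close>

lemma unitary_conj_eq_iff:
  fixes a x y :: "'a::cstar_algebra"
  assumes "unitary a"
  shows "a * x * star a = y \<longleftrightarrow> x = star a * y * a"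
proof -
  have "star a * (a * x * star a) * a = (star a * a) * x * (star a * a)"
    "a * (star a * y * a) * star a = (a * star a) * y * (a * star a)"
    by (simp_all only: mult.assoc)
  then show ?thesis using assms by (auto simp: unitary_def)
qed

theorem proposition6p2:
  fixes S :: "nat \<Rightarrow> 'a::cstar_algebra" and n :: nat
  assumes "n \<ge> 2" and "is_cuntz_algebra n S"
  shows
    "(\<forall>k h U V. k \<ge> 1 \<longrightarrow> h \<ge> 1 \<longrightarrow>
        unitary U \<longrightarrow> U \<in> cuntz_core n S k \<longrightarrow>
        unitary V \<longrightarrow> V \<in> cuntz_core n S h \<longrightarrow>
        cocyc n S U h * V * star (cocyc n S U h) = star U \<longrightarrow>
        cocyc n S V k * U * star (cocyc n S V k) = star V \<longrightarrow>
        (let r = max k h; Ur = cocyc n S U r; W = cocyc n S (star Ur * star U * Ur) r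
         in W * U * star W = star Ur * U * Ur))
     \<and>
     (\<forall>r U. r \<ge> 1 \<longrightarrow> unitary U \<longrightarrow> U \<in> cuntz_core n S r \<longrightarrow>
        (let Ur = cocyc n S U r; V = star Ur * star U * Ur; W = cocyc n S V r
         in W * U * star W = star Ur * U * Ur \<longrightarrow>
            unitary V \<and>
            (\<exists>!f. induced_by n S U f) \<and> (\<exists>!f. induced_by n S V f) \<and>
            star_automorphism (cuntz_endo n S U) \<and>
            inv (cuntz_endo n S U) = cuntz_endo n S V))"
proof -
  interpret cuntz_algebra n S
    using assms by unfold_locales (auto simp: is_cuntz_algebra_def)
  show ?thesis
  proof (intro conjI allI impI)
    fix k h U V
    assume U: "unitary U" "U \<in> cuntz_core n S k" and V: "unitary V" "V \<in> cuntz_core n S h"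
      and UV: "cocyc n S U h * V * star (cocyc n S U h) = star U"
      and VU: "cocyc n S V k * U * star (cocyc n S V k) = star V"
    define r where "r = max k h"
    have "cc U r * V * star (cc U r) = star U"
      using cocyc_conj_core[OF U(1) V(2), of r] UV by (simp add: r_def)
    then have V_eq: "V = star (cc U r) * star U * cc U r"
      using unitary_conj_eq_iff[OF cocyc_unitary[OF U(1)]] by blast
    have "cc V r * U * star (cc V r) = star V"
      using cocyc_conj_core[OF V(1) U(2), of r] VU by (simp add: r_def)
    also have "star V = star (cc U r) * U * cc U r"
      by (simp add: V_eq star_mult mult.assoc)
    finally show "let r = max k h; Ur = cocyc n S U r; W = cocyc n S (star Ur * star U * Ur) r
        in W * U * star W = star Ur * U * Ur"
      by (simp add: Let_def r_def[symmetric] V_eq[symmetric])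
  next
    fix r U
    assume U: "unitary U" "U \<in> cuntz_core n S r"
    define V where "V = star (cc U r) * star U * cc U r"
    have V: "unitary V"
      using U(1) by (simp add: V_def unitary_mult unitary_star cocyc_unitary)
    have "star_automorphism (cuntz_endo n S U) \<and> inv (cuntz_endo n S U) = cuntz_endo n S V"
      if "cc V r * U * star (cc V r) = star (cc U r) * U * cc U r"
    proof -
      have "cuntz_endo n S V U = star V"
        using cuntz_endo_core[OF V U(2)] that by (simp add: V_def star_mult mult.assoc)
      then show ?thesis using cuntz_endo_inverse[OF U(1) V] by blast
    qed
    then show "let Ur = cocyc n S U r; V = star Ur * star U * Ur; W = cocyc n S V r
        in W * U * star W = star Ur * U * Ur \<longrightarrow>
          unitary V \<and> (\<exists>!f. induced_by n S U f) \<and> (\<exists>!f. induced_by n S V f) \<and>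
          star_automorphism (cuntz_endo n S U) \<and> inv (cuntz_endo n S U) = cuntz_endo n S V"
      unfolding Let_def V_def[symmetric]
      using V ex1_induced_by[OF U(1)] ex1_induced_by[OF V] by blast
  qed
qed

end
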